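(* Let $v\geq 2$, and let $G$ be a maximal weakly $(2,v)$-clique-partitioned graph. Then $G$ is isomorphic to $\Gamma'(2,v)$.
   Context: A $v$-clique is a set of $v$ pairwise adjacent vertices. A graph of order $nv$ is weakly $(n,v)$-clique-partitioned if its vertex set can be decomposed in a unique way into $n$ vertex-disjoint $v$-cliques. Every weakly $(n,v)$-clique-partitioned graph has at most $\binom{nv}{2}-\frac{n(n-1)v}{2}$ edges; one is called maximal if it has exactly this many edges. The graph $\Gamma'(n,v)$ has vertex set $\{(i,j):0\leq i\leq n-1,\ 0\leq j\leq v-1\}$ and is obtained from the complete graph on this vertex set by removing all edges joining $(i,0)$ to $(k,\ell)$ for all $0\leq i\leq n-2$, $i<k\leq n-1$, $0\leq \ell\leq v-1$. *)

theory Defs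
  imports
    "HOL-Library.Disjoint_Sets"
    "Graph_Theory.Pair_Digraph"
    "Graph_Theory.Digraph_Isomorphism"
begin

text \<open>
  Finite simple graphs are \<^locale>\<open>pair_graph\<close>s: finite, loop-free, symmetric
  digraphs without parallel arcs. An undirected edge is a pair of opposite arcs, so edges are
  counted as two-element sets.
\<close>

definition undirected_edges :: "'a pair_pre_digraph \<Rightarrow> 'a set set" where
  "undirected_edges G = {{x, y} | x y. (x, y) \<in> parcs G}"

definition is_clique :: "'a pair_pre_digraph \<Rightarrow> nat \<Rightarrow> 'a set \<Rightarrow> bool" where
  "is_clique G v C \<longleftrightarrow>
     C \<subseteq> pverts G \<and> card C = v \<and> (\<forall>x\<in>C. \<forall>y\<in>C. x \<noteq> y \<longrightarrow> (x, y) \<in> parcs G)"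

definition clique_partition :: "'a pair_pre_digraph \<Rightarrow> nat \<Rightarrow> nat \<Rightarrow> 'a set set \<Rightarrow> bool" where
  "clique_partition G n v P \<longleftrightarrow>
     partition_on (pverts G) P \<and> card P = n \<and> (\<forall>C\<in>P. is_clique G v C)"

definition weakly_clique_partitioned :: "nat \<Rightarrow> nat \<Rightarrow> 'a pair_pre_digraph \<Rightarrow> bool" where
  "weakly_clique_partitioned n v G \<longleftrightarrow>
     pair_graph G \<and> card (pverts G) = n * v \<and> (\<exists>!P. clique_partition G n v P)"

text \<open>
  Maximality means attaining the upper bound on the number of edges of a weakly
  clique-partitioned graph; the bound is written over the reals to avoid truncated subtraction.
\<close>

definition maximal_weakly_clique_partitioned :: "nat \<Rightarrow> nat \<Rightarrow> 'a pair_pre_digraph \<Rightarrow> bool" where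
  "maximal_weakly_clique_partitioned n v G \<longleftrightarrow>
     weakly_clique_partitioned n v G \<and>
     real (card (undirected_edges G)) =
       real ((n * v) choose 2) - real n * (real n - 1) * real v / 2"

text \<open>
  The condition \<open>i + 1 < n\<close> is \<open>i \<le> n - 2\<close> without truncated subtraction.
\<close>

definition Gamma_prime_removed :: "nat \<Rightarrow> nat \<Rightarrow> (nat \<times> nat) rel" where
  "Gamma_prime_removed n v =
     {((i, 0), (k, l)) | i k l. i + 1 < n \<and> i < k \<and> k < n \<and> l < v}"

definition Gamma_prime :: "nat \<Rightarrow> nat \<Rightarrow> (nat \<times> nat) pair_pre_digraph" where
  "Gamma_prime n v =
     \<lparr> pverts = {..<n} \<times> {..<v},
       parcs = {(x, y). x \<in> {..<n} \<times> {..<v} \<and> y \<in> {..<n} \<times> {..<v} \<and> x \<noteq> y}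
                - (Gamma_prime_removed n v \<union> (Gamma_prime_removed n v)\<inverse>) \<rparr>"

lemma pair_graph_Gamma_prime: "pair_graph (Gamma_prime n v)"
proof -
  have "finite (parcs (Gamma_prime n v))"
    by (rule finite_subset[of _ "({..<n} \<times> {..<v}) \<times> ({..<n} \<times> {..<v})"])
      (auto simp: Gamma_prime_def)
  then show ?thesis
    by unfold_locales (auto simp: Gamma_prime_def symmetric_def sym_def)
qed

end

theory Submission
  imports Defs
begin

text \<open>
  The vertex set splits into two cliques \<open>A\<close> and \<open>B\<close>, and by the edge count exactly \<open>v\<close> pairs of
  \<open>A \<times> B\<close> are non-adjacent. Exchanging subsets \<open>S\<close> of \<open>A\<close> and \<open>T\<close> of \<open>B\<close> of equal size gives
  another clique partition as soon as no non-adjacent pair joins \<open>S\<close> to \<open>B - T\<close> or \<open>A - S\<close> to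
  \<open>T\<close>. So \<open>A\<close> and \<open>B\<close> cannot both contain a vertex adjacent to the whole other clique. Say \<open>B\<close>
  contains none. Then each of its \<open>v\<close> vertices lies in exactly one non-adjacent pair, that is, the
  non-adjacent pairs form stars centred in \<open>A\<close>. If there were two or more stars, one with \<open>k < v\<close>
  leaves could be exchanged, padding its centre with \<open>k - 1\<close> vertices of \<open>A\<close> that are in no
  non-adjacent pair. Hence there is a single star.
\<close>

section \<open>Bipartite relations that no exchange respects\<close>

text \<open>\<open>N\<close> stands for the non-adjacent pairs, \<open>unsplit\<close> for the
  failure of every exchange. The converse of \<open>N\<close> is a second instance, for the case
  that \<open>A\<close> is the covered side.\<close>

lemma star_if_covering_and_unbalanced:
  fixes A :: "'a set" and B :: "'b set" and N :: "('a \<times> 'b) set"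
  assumes fin: "finite A" "finite B"
    and card: "card A = card B" "card N = card B" and "B \<noteq> {}"
    and N: "N \<subseteq> A \<times> B" and cover: "B \<subseteq> snd ` N"
    and unsplit: "\<And>S T. S \<subseteq> A \<Longrightarrow> T \<subseteq> B \<Longrightarrow> card S = card T \<Longrightarrow> S \<noteq> {} \<Longrightarrow> S \<noteq> A \<Longrightarrow>
      \<exists>(x, y) \<in> N. x \<in> S \<longleftrightarrow> y \<notin> T"
  shows "\<exists>a\<in>A. N = {a} \<times> B"
proof -
  have finN: "finite N"
    using N fin by (meson finite_SigmaI finite_subset)
  have "snd ` N = B"
    using N cover by auto
  then have inj: "inj_on snd N"
    using card finN by (simp add: eq_card_imp_inj_on)
  obtain a b where ab: "(a, b) \<in> N"
    using \<open>B \<noteq> {}\<close> cover by fastforce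
  define T where "T = N `` {a}"
  have TB: "T \<subseteq> B" and aA: "a \<in> A" and bT: "b \<in> T"
    using N ab by (auto simp: T_def)
  have finT: "finite T"
    using TB fin(2) finite_subset by blast
  have star: "{a} \<times> T \<subseteq> N"
    by (auto simp: T_def)
  have "T = B"
  proof (rule ccontr)
    assume "T \<noteq> B"
    with TB fin have Tless: "card T < card B"
      by (simp add: psubset_card_mono psubsetI)
    have Tpos: "card T > 0"
      using bT finT card_gt_0_iff by blast
    \<comment> \<open>Each pair outside the star at \<open>a\<close> adds at most one further
      centre, so at least \<open>card T - 1\<close> vertices of \<open>A\<close> lie in no pair;
      these can pad \<open>a\<close>.\<close>
    have "fst ` N \<subseteq> insert a (fst ` (N - {a} \<times> T))"
      by (force simp: T_def)
    then have "card (fst ` N) \<le> card (insert a (fst ` (N - {a} \<times> T)))"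
      using finN by (intro card_mono) auto
    also have "\<dots> \<le> Suc (card (fst ` (N - {a} \<times> T)))"
      by (rule card_insert_le_m1[of "Suc _", simplified]) auto
    also have "\<dots> \<le> Suc (card (N - {a} \<times> T))"
      using finN by (simp add: card_image_le)
    also have "card (N - {a} \<times> T) = card B - card T"
      using star finT card by (simp add: card_Diff_subset card_cartesian_product)
    finally have "card (fst ` N) \<le> Suc (card B - card T)" .
    moreover have "card (A - fst ` N) = card A - card (fst ` N)"
      using N finN by (intro card_Diff_subset) auto
    ultimately have "card T - 1 \<le> card (A - fst ` N)"
      using card Tless by linarith
    then obtain U where U: "U \<subseteq> A - fst ` N" "card U = card T - 1"
      by (meson obtain_subset_with_card_n)
    have "a \<notin> U"
      using U ab by force
    moreover have "finite U"
      using U fin finite_subset by blast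
    ultimately have cardS: "card (insert a U) = card T"
      using U Tpos by simp
    have "insert a U \<noteq> A"
      using cardS Tless card by auto
    \<comment> \<open>No such pair can exist: \<open>U\<close> avoids all pairs, and by injectivity
      of \<open>snd\<close> the pairs ending in \<open>T\<close> are exactly those starting at
      \<open>a\<close>.\<close>
    then obtain x y where xy: "(x, y) \<in> N" "x \<in> insert a U \<longleftrightarrow> y \<notin> T"
      using unsplit[of "insert a U" T] U aA TB cardS by blast
    have "x \<notin> U"
      using xy(1) U by force
    moreover have "x = a" if "y \<in> T"
      using inj_onD[OF inj, of "(x, y)" "(a, y)"] xy(1) that by (simp add: T_def)
    moreover have "y \<in> T" if "x = a"
      using xy(1) that by (simp add: T_def)
    ultimately show False
      using xy(2) by blast
  qed
  then have "{a} \<times> B = N"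
    using star card finN by (intro card_subset_eq) (auto simp: card_cartesian_product)
  then show ?thesis
    using aA by blast
qed

text \<open>If \<open>N\<close> covers one side, the star lemma applies to \<open>N\<close> or to
  its converse. Otherwise each side has a vertex in no pair, and swapping just these two violates
  \<open>unsplit\<close>.\<close>

lemma star_if_unbalanced:
  fixes A :: "'a set" and B :: "'b set" and N :: "('a \<times> 'b) set"
  assumes fin: "finite A" "finite B"
    and card: "card A = card B" "card N = card B" "card B \<ge> 2"
    and N: "N \<subseteq> A \<times> B"
    and unsplit: "\<And>S T. S \<subseteq> A \<Longrightarrow> T \<subseteq> B \<Longrightarrow> card S = card T \<Longrightarrow> S \<noteq> {} \<Longrightarrow> S \<noteq> A \<Longrightarrow>
      \<exists>(x, y) \<in> N. x \<in> S \<longleftrightarrow> y \<notin> T"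
  shows "(\<exists>a\<in>A. N = {a} \<times> B) \<or> (\<exists>b\<in>B. N = A \<times> {b})"
proof -
  consider "B \<subseteq> snd ` N" | "A \<subseteq> fst ` N" | "\<not> B \<subseteq> snd ` N" "\<not> A \<subseteq> fst ` N"
    by blast
  then show ?thesis
  proof cases
    case 1
    have "B \<noteq> {}"
      using card by auto
    from star_if_covering_and_unbalanced[OF fin card(1,2) this N 1 unsplit] show ?thesis
      by blast
  next
    case 2
    have "\<exists>b\<in>B. N\<inverse> = {b} \<times> A"
    proof (rule star_if_covering_and_unbalanced)
      show "A \<subseteq> snd ` N\<inverse>"
        using 2 by force
      show "\<exists>(x, y) \<in> N\<inverse>. x \<in> S \<longleftrightarrow> y \<notin> T"
        if "S \<subseteq> B" "T \<subseteq> A" "card S = card T" "S \<noteq> {}" "S \<noteq> B" for S T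
      proof -
        \<comment> \<open>The subset of \<open>A\<close> is now \<open>T\<close>; equal
          cardinalities carry non-emptiness and properness over from \<open>S\<close>.\<close>
        have "T \<noteq> {}" "T \<noteq> A"
          using that card fin finite_subset[OF that(1)]
          by (auto dest: card_subset_eq[OF fin(2)])
        then show ?thesis
          using unsplit[of T S] that by fastforce
      qed
    qed (use fin card N in \<open>auto simp: card_inverse\<close>)
    then obtain b where b: "b \<in> B" "N\<inverse> = {b} \<times> A"
      by blast
    then have "N = A \<times> {b}"
      by (metis converse_Times converse_converse)
    then show ?thesis
      using b by blast
  next
    case 3
    then obtain a b where ab: "a \<in> A" "a \<notin> fst ` N" "b \<in> B" "b \<notin> snd ` N"
      by blast
    have "{a} \<noteq> A"
      using card by auto
    then obtain x y where "(x, y) \<in> N" "x = a \<longleftrightarrow> y \<noteq> b"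
      using unsplit[of "{a}" "{b}"] ab(1,3) by auto
    then show ?thesis
      using ab(2,4) by (metis fst_conv imageI snd_conv)
  qed
qed

section \<open>Recognising \<open>Gamma_prime 2 v\<close>\<close>

text \<open>An arc is the ordered pair of its ends, so the vertex bijection already determines the
  arc map \<open>map_prod f f\<close>.\<close>

lemma digraph_iso_with_projI:
  assumes "pair_wf_digraph G" "pair_wf_digraph H"
    and bij: "bij_betw f (pverts G) (pverts H)"
    and arcs: "\<And>x y. x \<in> pverts G \<Longrightarrow> y \<in> pverts G \<Longrightarrow>
      (x, y) \<in> parcs G \<longleftrightarrow> (f x, f y) \<in> parcs H"
  shows "digraph_iso (with_proj G) (with_proj H)"
proof -
  interpret G: pair_wf_digraph G by fact
  interpret H: pair_wf_digraph H by fact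
  \<comment> \<open>\<open>iso_tail\<close> and \<open>iso_head\<close> are the tail and head
    functions of the image digraph, hence the projections.\<close>
  let ?hom = "\<lparr>iso_verts = f, iso_arcs = map_prod f f, iso_head = snd, iso_tail = fst\<rparr>"
  have inj: "inj_on f (pverts G)" and img: "f ` pverts G = pverts H"
    using bij by (auto simp: bij_betw_def)
  have "inj_on (map_prod f f) (parcs G)"
    using map_prod_inj_on[OF inj inj] by (rule inj_on_subset) (auto dest: G.wellformed')
  then have "G.digraph_isomorphism ?hom"
    using inj G.wf_digraph_axioms by (auto simp: G.digraph_isomorphism_def)
  moreover have "map_prod f f ` parcs G = parcs H"
  proof
    show "map_prod f f ` parcs G \<subseteq> parcs H"
      using arcs by (auto dest: G.wellformed')
    show "parcs H \<subseteq> map_prod f f ` parcs G"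
    proof
      fix e assume e: "e \<in> parcs H"
      then obtain x y where "x \<in> pverts G" "y \<in> pverts G" "e = (f x, f y)"
        using H.wellformed' img by (metis imageE prod.exhaust)
      then show "e \<in> map_prod f f ` parcs G"
        using e arcs by force
    qed
  qed
  then have "with_proj H = app_iso ?hom (with_proj G)"
    by (simp add: with_proj_def app_iso_def img)
  ultimately show ?thesis
    unfolding digraph_iso_def by blast
qed

text \<open>For n = 2 the removed edges are those joining (0, 0) to row 1. So \<open>a\<close> goes
  to (0, 0), the rest of \<open>A\<close> fills row 0, and \<open>B\<close> becomes row 1.\<close>

lemma (in pair_graph) digraph_iso_Gamma_prime_2:
  assumes verts: "pverts G = A \<union> B" "A \<inter> B = {}"
    and cliques: "is_clique G v A" "is_clique G v B"
    and a: "a \<in> A"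
    and cross: "\<And>x y. x \<in> A \<Longrightarrow> y \<in> B \<Longrightarrow> (x, y) \<in> parcs G \<longleftrightarrow> x \<noteq> a"
  shows "digraph_iso (with_proj G) (with_proj (Gamma_prime 2 v))"
proof -
  have fin: "finite A" "finite B" and card: "card A = v" "card B = v"
    using pair_finite_verts verts cliques by (auto simp: is_clique_def)
  have arcs: "(x, y) \<in> parcs G \<longleftrightarrow> x \<noteq> y \<and> \<not> (x = a \<and> y \<in> B) \<and> \<not> (y = a \<and> x \<in> B)"
    if xy: "x \<in> A \<union> B" "y \<in> A \<union> B" for x y
  proof -
    have sym: "(x, y) \<in> parcs G \<longleftrightarrow> (y, x) \<in> parcs G"
      using arcs_symmetric by blast
    have "x \<noteq> y \<Longrightarrow> (x, y) \<in> parcs G" if "x \<in> A \<and> y \<in> A \<or> x \<in> B \<and> y \<in> B"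
      using cliques that by (auto simp: is_clique_def)
    then show ?thesis
      using xy sym cross[of x y] cross[of y x] no_loops'[of x y] verts(2) a by blast
  qed
  have "v > 0"
    using a fin(1) card(1) card_gt_0_iff by blast
  \<comment> \<open>The value 0 is left out because (0, 0) is reserved for \<open>a\<close>.\<close>
  have "card (A - {a}) = card {1..<v}"
    using a card by simp
  then obtain h where h: "bij_betw h (A - {a}) {1..<v}"
    using fin by (metis finite_Diff finite_atLeastLessThan finite_same_card_bij)
  obtain k where k: "bij_betw k B {..<v}"
    using fin card by (metis card_lessThan finite_lessThan finite_same_card_bij)
  define f where "f x = (if x = a then (0, 0) else if x \<in> A then (0, h x) else (1::nat, k x))" for x
  have hD: "h x \<in> {1..<v}" if "x \<in> A" "x \<noteq> a" for x
    using bij_betw_apply[OF h, of x] that by simp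
  have kD: "k x \<in> {..<v}" if "x \<in> B" for x
    using bij_betw_apply[OF k, of x] that by simp
  have inj: "inj_on f (A \<union> B)"
  proof (rule inj_onI)
    fix x y assume xy: "x \<in> A \<union> B" "y \<in> A \<union> B" "f x = f y"
    show "x = y"
      using xy hD[of x] hD[of y] inj_onD[OF bij_betw_imp_inj_on[OF h], of x y]
        inj_onD[OF bij_betw_imp_inj_on[OF k], of x y]
      by (auto simp: f_def split: if_splits)
  qed
  have "f ` (A \<union> B) \<subseteq> {..<2} \<times> {..<v}"
  proof (rule image_subsetI)
    fix x assume "x \<in> A \<union> B"
    then show "f x \<in> {..<2} \<times> {..<v}"
      using hD[of x] kD[of x] \<open>v > 0\<close> by (auto simp: f_def)
  qed
  moreover have "card (f ` (A \<union> B)) = card ({..<2::nat} \<times> {..<v})"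
    using inj card fin verts(2) by (simp add: card_image card_Un_disjoint card_cartesian_product)
  ultimately have bij: "bij_betw f (A \<union> B) ({..<2} \<times> {..<v})"
    using inj by (simp add: bij_betw_def card_subset_eq)
  show ?thesis
  proof (rule digraph_iso_with_projI)
    show "pair_wf_digraph (Gamma_prime 2 v)"
      using pair_graph_Gamma_prime[of 2 v]
      by (simp add: pair_graph_def pair_digraph_def pair_fin_digraph_def)
    show "bij_betw f (pverts G) (pverts (Gamma_prime 2 v))"
      using bij verts by (simp add: Gamma_prime_def)
    fix x y assume xy: "x \<in> pverts G" "y \<in> pverts G"
    have removed: "(f s, f t) \<in> Gamma_prime_removed 2 v \<longleftrightarrow> s = a \<and> t \<in> B"
      if "s \<in> A \<union> B" "t \<in> A \<union> B" for s t
      using that hD kD verts(2) a by (fastforce simp: Gamma_prime_removed_def f_def split: if_splits)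
    have "(f x, f y) \<in> parcs (Gamma_prime 2 v) \<longleftrightarrow>
        f x \<noteq> f y \<and> (f x, f y) \<notin> Gamma_prime_removed 2 v \<and> (f y, f x) \<notin> Gamma_prime_removed 2 v"
      using xy verts bij_betw_apply[OF bij] by (auto simp: Gamma_prime_def)
    also have "\<dots> \<longleftrightarrow> x \<noteq> y \<and> \<not> (x = a \<and> y \<in> B) \<and> \<not> (y = a \<and> x \<in> B)"
      using xy verts removed inj_on_eq_iff[OF inj] by simp
    also have "\<dots> \<longleftrightarrow> (x, y) \<in> parcs G"
      using xy verts arcs by simp
    finally show "(x, y) \<in> parcs G \<longleftrightarrow> (f x, f y) \<in> parcs (Gamma_prime 2 v)" ..
  qed (rule pair_wf_digraph)
qed

section \<open>Edge count and exchange for two cliques\<close>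

text \<open>Inside \<open>A\<close> or \<open>B\<close> every two-element set is an edge, so all
  non-edges come from \<open>A \<times> B\<close>; disjointness makes each come from only one
  ordered pair.\<close>

lemma (in pair_graph) card_undirected_edges_two_cliques:
  assumes verts: "pverts G = A \<union> B" "A \<inter> B = {}"
    and cliques: "is_clique G v A" "is_clique G w B"
  shows "card (undirected_edges G) + card {(x, y) \<in> A \<times> B. (x, y) \<notin> parcs G} =
    card (pverts G) choose 2"
proof -
  let ?N = "{(x, y) \<in> A \<times> B. (x, y) \<notin> parcs G}"
  let ?E = "(\<lambda>(x, y). {x, y}) ` ?N"
  let ?K = "{e. e \<subseteq> pverts G \<and> card e = 2}"
  have U: "{x, y} \<in> undirected_edges G \<longleftrightarrow> (x, y) \<in> parcs G" for x y
    by (auto simp: undirected_edges_def doubleton_eq_iff arcs_symmetric)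
  have "inj_on (\<lambda>(x, y). {x, y}) ?N"
    using verts(2) by (auto simp: inj_on_def doubleton_eq_iff)
  then have cardE: "card ?E = card ?N"
    by (rule card_image)
  have K: "?K = undirected_edges G \<union> ?E"
  proof
    show "undirected_edges G \<union> ?E \<subseteq> ?K"
    proof
      fix e assume "e \<in> undirected_edges G \<union> ?E"
      then obtain x y where "e = {x, y}" "(x, y) \<in> parcs G \<or> x \<in> A \<and> y \<in> B"
        by (auto simp: undirected_edges_def)
      moreover from this have "x \<in> A \<union> B" "y \<in> A \<union> B" "x \<noteq> y"
        using verts in_arcsD1[of x y] in_arcsD2[of x y] no_loops'[of x y] by auto
      ultimately show "e \<in> ?K"
        using verts by simp
    qed
    show "?K \<subseteq> undirected_edges G \<union> ?E"
    proof
      fix e assume "e \<in> ?K"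
      then obtain x y where e: "e = {x, y}" "x \<noteq> y" "x \<in> A \<union> B" "y \<in> A \<union> B"
        using verts by (auto simp: card_2_iff)
      show "e \<in> undirected_edges G \<union> ?E"
      proof (cases "(x, y) \<in> parcs G")
        case False
        then have "(y, x) \<notin> parcs G"
          using arcs_symmetric by blast
        with False have "(x, y) \<in> ?N \<or> (y, x) \<in> ?N"
          using e cliques by (auto simp: is_clique_def)
        then show ?thesis
          using e(1) by (force simp: insert_commute)
      qed (simp add: e(1) U)
    qed
  qed
  have fin: "finite ?K"
    using pair_finite_verts by simp
  have "undirected_edges G \<inter> ?E = {}"
    by (auto simp: U)
  moreover have "finite (undirected_edges G)" "finite ?E"
    using fin unfolding K by simp_all
  ultimately have "card ?K = card (undirected_edges G) + card ?E"
    unfolding K by (intro card_Un_disjoint)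
  then show ?thesis
    using cardE pair_finite_verts by (simp add: n_subsets)
qed

text \<open>The new parts need adjacency between \<open>A - S\<close> and \<open>T\<close> and
  between \<open>S\<close> and \<open>B - T\<close>, which is what \<open>split\<close> provides.
  Equal cardinalities preserve the sizes; \<open>S \<noteq> A\<close> and
  \<open>S \<noteq> {}\<close> keep the parts non-empty.\<close>

lemma clique_partition_exchange:
  assumes "symmetric (with_proj G)"
    and verts: "pverts G = A \<union> B" "A \<inter> B = {}"
    and fin: "finite A" "finite B"
    and cliques: "is_clique G v A" "is_clique G v B"
    and ST: "S \<subseteq> A" "T \<subseteq> B" "card S = card T" "S \<noteq> {}" "S \<noteq> A"
    and split: "\<And>x y. x \<in> A \<Longrightarrow> y \<in> B \<Longrightarrow> (x, y) \<notin> parcs G \<Longrightarrow> x \<in> S \<longleftrightarrow> y \<in> T"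
  shows "clique_partition G 2 v {A - S \<union> T, B - T \<union> S}"
proof -
  let ?A' = "A - S \<union> T" and ?B' = "B - T \<union> S"
  have sym: "(y, x) \<in> parcs G" if "(x, y) \<in> parcs G" for x y
    using assms(1) that by (auto simp: symmetric_def elim: symE)
  have finST: "finite S" "finite T"
    using ST fin finite_subset by blast+
  have le: "card S \<le> card A" "card T \<le> card B"
    using card_mono[OF fin(1) ST(1)] card_mono[OF fin(2) ST(2)] .
  have "card ?A' = card (A - S) + card T"
    using ST verts(2) fin finST by (intro card_Un_disjoint) auto
  then have cA: "card ?A' = v"
    using ST cliques finST le by (simp add: card_Diff_subset is_clique_def)
  have "card ?B' = card (B - T) + card S"
    using ST verts(2) fin finST by (intro card_Un_disjoint) auto
  then have cB: "card ?B' = v"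
    using ST cliques finST le by (simp add: card_Diff_subset is_clique_def)
  have disj: "?A' \<inter> ?B' = {}" and un: "?A' \<union> ?B' = pverts G"
    using ST verts by auto
  have ne: "?A' \<noteq> {}" "?B' \<noteq> {}"
    using ST by auto
  have cross: "(x, y) \<in> parcs G \<and> (y, x) \<in> parcs G"
    if "x \<in> A" "y \<in> B" "x \<in> S \<longleftrightarrow> y \<notin> T" for x y
    using split sym that by blast
  have inA: "(x, y) \<in> parcs G" if "x \<in> A" "y \<in> A" "x \<noteq> y" for x y
    using cliques(1) that by (simp add: is_clique_def)
  have inB: "(x, y) \<in> parcs G" if "x \<in> B" "y \<in> B" "x \<noteq> y" for x y
    using cliques(2) that by (simp add: is_clique_def)
  have "(x, y) \<in> parcs G" if "x \<in> ?A'" "y \<in> ?A'" "x \<noteq> y" for x y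
    using that inA[of x y] inB[of x y] cross[of x y] cross[of y x] ST(1,2) verts(2) by blast
  then have "is_clique G v ?A'"
    using cA un unfolding is_clique_def by blast
  moreover have "(x, y) \<in> parcs G" if "x \<in> ?B'" "y \<in> ?B'" "x \<noteq> y" for x y
    using that inA[of x y] inB[of x y] cross[of x y] cross[of y x] ST(1,2) verts(2) by blast
  then have "is_clique G v ?B'"
    using cB un unfolding is_clique_def by blast
  moreover have "partition_on (pverts G) {?A', ?B'}"
    using disj un ne by (auto simp: partition_on_def disjoint_def)
  moreover have "card {?A', ?B'} = 2"
    using disj ne by (subst card_2_iff) auto
  ultimately show ?thesis
    by (simp add: clique_partition_def)
qed

section \<open>From uniqueness and maximality to a single star\<close>

theorem theorem3p3:
  fixes G :: "'a pair_pre_digraph" and v :: nat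
  assumes "v \<ge> 2"
    and "maximal_weakly_clique_partitioned 2 v G"
  shows "digraph_iso (with_proj G) (with_proj (Gamma_prime 2 v))"
proof -
  have weak: "weakly_clique_partitioned 2 v G"
    and edges: "real (card (undirected_edges G)) = real ((2 * v) choose 2) - real v"
    using assms(2) by (auto simp: maximal_weakly_clique_partitioned_def)
  interpret pair_graph G
    using weak by (simp add: weakly_clique_partitioned_def)
  obtain P where P: "clique_partition G 2 v P" and uniq: "\<And>Q. clique_partition G 2 v Q \<Longrightarrow> Q = P"
    using weak by (auto simp: weakly_clique_partitioned_def)
  obtain A B where AB: "P = {A, B}" "A \<noteq> B"
    using P unfolding clique_partition_def card_2_iff by blast
  have verts: "pverts G = A \<union> B" "A \<inter> B = {}"
    and cliques: "is_clique G v A" "is_clique G v B"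
    using P AB by (auto simp: clique_partition_def partition_on_def disjoint_def)
  have fin: "finite A" "finite B"
    using pair_finite_verts verts by auto
  have cards: "card A = v" "card B = v"
    using cliques by (auto simp: is_clique_def)
  let ?N = "{(x, y) \<in> A \<times> B. (x, y) \<notin> parcs G}"
  have "card (undirected_edges G) + card ?N = (2 * v) choose 2"
    using card_undirected_edges_two_cliques[OF verts cliques] weak
    by (simp add: weakly_clique_partitioned_def)
  \<comment> \<open>The deficit n(n - 1)v/2 equals v for n = 2.\<close>
  then have cardN: "card ?N = v"
    using edges by linarith
  have unsplit: "\<exists>(x, y) \<in> ?N. x \<in> S \<longleftrightarrow> y \<notin> T"
    if ST: "S \<subseteq> A" "T \<subseteq> B" "card S = card T" "S \<noteq> {}" "S \<noteq> A" for S T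
  proof (rule ccontr)
    assume "\<not> ?thesis"
    then have split: "x \<in> S \<longleftrightarrow> y \<in> T" if "x \<in> A" "y \<in> B" "(x, y) \<notin> parcs G" for x y
      using that by blast
    have "clique_partition G 2 v {A - S \<union> T, B - T \<union> S}"
      by (rule clique_partition_exchange[OF sym_arcs verts fin cliques ST split])
    then have "{A - S \<union> T, B - T \<union> S} = {A, B}"
      using uniq[of "{A - S \<union> T, B - T \<union> S}"] AB(1) by simp
    \<comment> \<open>As \<open>A\<close> and \<open>B\<close> are disjoint, the first equation
      forces \<open>T = {}\<close>, hence \<open>S = {}\<close>, and the second forces
      \<open>S = A\<close>.\<close>
    then have "A - S \<union> T = A \<or> A - S \<union> T = B"
      by (auto simp: doubleton_eq_iff)
    then have "T = {} \<or> S = A"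
      using ST(1,2) verts(2) by auto
    then show False
      using ST(3-5) finite_subset[OF ST(1) fin(1)] by auto
  qed
  have "(\<exists>a\<in>A. ?N = {a} \<times> B) \<or> (\<exists>b\<in>B. ?N = A \<times> {b})"
    by (rule star_if_unbalanced[OF fin _ _ _ _ unsplit]) (use cards cardN assms(1) in auto)
  then consider a where "a \<in> A" "?N = {a} \<times> B" | b where "b \<in> B" "?N = A \<times> {b}"
    by blast
  then show ?thesis
  proof cases
    case 1
    then have "(x, y) \<in> parcs G \<longleftrightarrow> x \<noteq> a" if "x \<in> A" "y \<in> B" for x y
      using that by auto
    then show ?thesis
      by (rule digraph_iso_Gamma_prime_2[OF verts cliques 1(1)])
  next
    case 2
    then have "(x, y) \<in> parcs G \<longleftrightarrow> y \<noteq> b" if "x \<in> A" "y \<in> B" for x y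
      using that by auto
    \<comment> \<open>The centre lies in \<open>B\<close>, so the two cliques change roles.\<close>
    then have "(y, x) \<in> parcs G \<longleftrightarrow> y \<noteq> b" if "y \<in> B" "x \<in> A" for x y
      using that arcs_symmetric by metis
    moreover have "pverts G = B \<union> A" "B \<inter> A = {}"
      using verts by auto
    ultimately show ?thesis
      using digraph_iso_Gamma_prime_2[of B A v b] cliques 2(1) by simp
  qed
qed

end
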